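(* For $c\in\mathbb R$, the ternary sextic form $$U_c(x,y,z)=x^2y^2(x-y)^2+y^2z^2(y-z)^2+z^2x^2(z-x)^2+c\,xyz(x-y)(y-z)(z-x)$$ is psd if and only if $|c|\le 4\sqrt{\sqrt2-1}$, and is sos only if $c=0$.
   Context: A real form is psd if it is nonnegative on all real points, and sos if it is a finite sum of squares of real forms. *)

theory Defs
  imports "HOL-Analysis.Analysis" "HOL-Library.Poly_Mapping"
begin

text \<open>Real polynomials in variables indexed by \<open>'n\<close>: finitely supported maps from exponent vectors
  to coefficients, with the (convolution) ring structure of the library.\<close>

type_synonym 'n rpoly = "('n \<Rightarrow>\<^sub>0 nat) \<Rightarrow>\<^sub>0 real"

definition var :: "'n \<Rightarrow> 'n rpoly" where
  "var i = Poly_Mapping.single (Poly_Mapping.single i 1) 1"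

definition const :: "real \<Rightarrow> 'n rpoly" where
  "const a = Poly_Mapping.single 0 a"

definition mdeg :: "('n::finite \<Rightarrow>\<^sub>0 nat) \<Rightarrow> nat" where
  "mdeg m = (\<Sum>i\<in>UNIV. Poly_Mapping.lookup m i)"

text \<open>As usual, the zero polynomial counts as a form of every degree.\<close>

definition is_form :: "nat \<Rightarrow> 'n::finite rpoly \<Rightarrow> bool" where
  "is_form d p \<longleftrightarrow> (\<forall>m\<in>Poly_Mapping.keys p. mdeg m = d)"

definition eval_at :: "real ^ 'n \<Rightarrow> 'n::finite rpoly \<Rightarrow> real" where
  "eval_at v p = (\<Sum>m\<in>Poly_Mapping.keys p.
      Poly_Mapping.lookup p m * (\<Prod>i\<in>UNIV. (v $ i) ^ Poly_Mapping.lookup m i))"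

definition psd :: "'n::finite rpoly \<Rightarrow> bool" where
  "psd p \<longleftrightarrow> (\<forall>v. eval_at v p \<ge> 0)"

definition sos :: "'n::finite rpoly \<Rightarrow> bool" where
  "sos p \<longleftrightarrow> (\<exists>fs. (\<forall>f\<in>set fs. \<exists>d. is_form d f) \<and> p = (\<Sum>f\<leftarrow>fs. f\<^sup>2))"

definition U :: "real \<Rightarrow> 3 rpoly" where
  "U c = (let x = var 1; y = var 2; z = var 3 in
     x^2 * y^2 * (x - y)^2 + y^2 * z^2 * (y - z)^2 + z^2 * x^2 * (z - x)^2
     + const c * x * y * z * (x - y) * (y - z) * (z - x))"

lemma mdeg_add: "mdeg (m + n) = mdeg m + mdeg n"
  by (simp add: mdeg_def lookup_add sum.distrib)

lemma is_form_add: "is_form d p \<Longrightarrow> is_form d q \<Longrightarrow> is_form d (p + q)"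
  using keys_add[of p q] by (auto simp: is_form_def)

lemma is_form_diff: "is_form d p \<Longrightarrow> is_form d q \<Longrightarrow> is_form d (p - q)"
  unfolding is_form_def by (metis Un_iff in_keys_iff lookup_minus diff_zero)

lemma is_form_mult: "is_form d p \<Longrightarrow> is_form e q \<Longrightarrow> is_form (d + e) (p * q)"
  using keys_mult[of p q] by (fastforce simp: is_form_def mdeg_add)

lemma is_form_const: "is_form 0 (const a)"
  by (auto simp: is_form_def const_def mdeg_def)

lemma is_form_var: "is_form 1 (var i)"
  by (auto simp: is_form_def var_def mdeg_def lookup_single when_def)

lemma is_form_U: "is_form 6 (U c)"
proof -
  have v: "is_form (Suc 0) (var i)" for i :: 3 using is_form_var[of i] by simp
  have d: "is_form (Suc 0) (var i - var j)" for i j :: 3 by (intro is_form_diff v)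
  have s: "is_form (2 + 2 + 2) ((p * p) * (q * q) * (r * r))"
    if "is_form (Suc 0) p" "is_form (Suc 0) q" "is_form (Suc 0) r" for p q r :: "3 rpoly"
    using that is_form_mult[of 1 _ 1] by (intro is_form_mult) (auto simp: numeral_2_eq_2)
  have t: "is_form (0 + 1 + 1 + 1 + 1 + 1 + 1)
      (const c * var 1 * var 2 * var 3 * (var 1 - var 2) * (var 2 - var 3) * (var 3 - var 1) :: 3 rpoly)"
    by (intro is_form_mult is_form_const) (simp_all add: v d)
  show ?thesis
    unfolding U_def Let_def power2_eq_square
    using s[OF v v d] t by (intro is_form_add) (simp_all add: numeral_eq_Suc)
qed

lemma eval_at_add: "eval_at v (p + q) = eval_at v p + eval_at v q"
  unfolding eval_at_def by (rule setsum_keys_plus_distrib) (simp_all add: algebra_simps)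

lemma eval_at_zero [simp]: "eval_at v 0 = 0"
  by (simp add: eval_at_def)

lemma eval_at_sum: "eval_at v (sum f A) = (\<Sum>a\<in>A. eval_at v (f a))"
  by (induction A rule: infinite_finite_induct) (simp_all add: eval_at_add)

lemma eval_at_diff: "eval_at v (p - q) = eval_at v p - eval_at v q"
  using eval_at_add[of v "p - q" q] by simp

lemma eval_at_single:
  "eval_at v (Poly_Mapping.single m a) = a * (\<Prod>i\<in>UNIV. (v $ i) ^ Poly_Mapping.lookup m i)"
  by (cases "a = 0") (simp_all add: eval_at_def)

lemma rpoly_expand:
  fixes p :: "'n rpoly"
  shows "p = (\<Sum>m\<in>Poly_Mapping.keys p. Poly_Mapping.single m (Poly_Mapping.lookup p m))"
  by (rule poly_mapping_eqI)
    (auto simp: lookup_sum lookup_single when_def sum.delta in_keys_iff)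

lemma eval_at_mult: "eval_at v (p * q) = eval_at v p * eval_at v q"
proof -
  have s: "eval_at v (Poly_Mapping.single m a * Poly_Mapping.single n b)
      = eval_at v (Poly_Mapping.single m a) * eval_at v (Poly_Mapping.single n b)" for m n a b
    by (simp add: mult_single eval_at_single lookup_add power_add prod.distrib)
  show ?thesis
    by (subst (1 2 3 4) rpoly_expand) (simp only: sum_product eval_at_sum s)
qed

lemma eval_at_const: "eval_at v (const a) = a"
  by (simp add: const_def eval_at_single)

lemma eval_at_var: "eval_at v (var i) = v $ i"
proof -
  have "(\<Prod>j\<in>UNIV. (v $ j) ^ Poly_Mapping.lookup (Poly_Mapping.single i 1) j)
      = (\<Prod>j\<in>UNIV. if j = i then v $ j else 1)"
    by (intro prod.cong) (auto simp: lookup_single when_def)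
  then show ?thesis
    by (simp add: var_def eval_at_single)
qed

lemma eval_at_U:
  "eval_at (vector [x, y, z]) (U c) =
     x^2 * y^2 * (x - y)^2 + y^2 * z^2 * (y - z)^2 + z^2 * x^2 * (z - x)^2
     + c * x * y * z * (x - y) * (y - z) * (z - x)"
  by (simp add: U_def Let_def power2_eq_square eval_at_add eval_at_diff eval_at_mult eval_at_const
      eval_at_var vector_3)

end

(* With r = (x - y)/z, s = (y - z)/x, t = (z - x)/y one has r + s + t = - r s t and
   U_c = (x y z)^2 (r^2 + s^2 + t^2 + c r s t).  Two of r, s, t have a product m <= 0, and eliminating
   the third leaves a quadratic in r + s whose discriminant is nonpositive when
   c^2 <= 16 (sqrt 2 - 1), by (m + sqrt 2)^2 >= 0.  Sharpness comes from r = s, r^2 = 1 + sqrt 2.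
   If f^2 is a summand in a representation of U_c as a sum of squares, then 0 <= f^2 <= U_c, so f is a
   cubic by homogeneity and vanishes at the zeros of U_c, among them the unit vectors, (1,1,0),
   (1,0,1), (0,1,1) and (1,1,1).  Hence f is in the span of x y (x - y), y z (y - z), z x (z - x), and
   quadratic forms in these three cubics cannot produce the term with c. *)

theory Submission
  imports Defs
begin

abbreviation ev :: "3 rpoly \<Rightarrow> real \<Rightarrow> real \<Rightarrow> real \<Rightarrow> real" where
  "ev f x y z \<equiv> eval_at (vector [x, y, z]) f"

section \<open>Positive semidefiniteness\<close>

lemma quadratic_form_nonneg:
  fixes a b d u v :: real
  assumes "a \<ge> 0" "d \<ge> 0" "b^2 \<le> 4 * a * d"
  shows "a * u^2 - b * u * v + d * v^2 \<ge> 0"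
proof (cases "a = 0")
  case True
  then show ?thesis using assms by simp
next
  case False
  have "4 * a * (a * u^2 - b * u * v + d * v^2) = (2 * a * u - b * v)^2 + (4 * a * d - b^2) * v^2"
    by (simp add: power2_eq_square algebra_simps)
  also have "\<dots> \<ge> 0" using assms by simp
  finally show ?thesis using False assms(1) by (simp add: zero_le_mult_iff)
qed

text \<open>Here \<open>h = z * x\<close> and r s = \<open>m\<close> / \<open>h\<close>, so the sign
  hypothesis says r s <= 0. Since \<open>h + m\<close> = y (x - y + z), eliminating t and clearing
  denominators gives a quadratic form in \<open>x - z\<close> and \<open>y\<close>, and zero
  coordinates need no separate case.\<close>

lemma U_nonneg_of_opposite_signs:
  fixes c x y z :: real
  assumes c: "c^2 \<le> 16 * (sqrt 2 - 1)" and sgn: "z * x * (x - y) * (y - z) \<le> 0"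
  shows "x^2 * y^2 * (x - y)^2 + y^2 * z^2 * (y - z)^2 + z^2 * x^2 * (z - x)^2
     + c * x * y * z * (x - y) * (y - z) * (z - x) \<ge> 0"
proof -
  define h where "h = z * x"
  define m where "m = (x - y) * (y - z)"
  define A where "A = (h + m)^2 + h^2"
  have hm: "h * m \<le> 0" using sgn by (simp add: h_def m_def algebra_simps)
  \<comment> \<open>This is (r s + sqrt 2)^2 times 8 \<open>h\<close>^2. The factor 8 matches the
    discriminant condition, which reads (8 A + c^2 h m) h m <= 0; the bound on c^2 turns around when
    multiplied by \<open>h * m\<close> <= 0.\<close>
  have "0 \<le> 8 * (sqrt 2 * h + m)^2" by simp
  also have "\<dots> = 8 * (2 * h^2 + m^2) + 16 * sqrt 2 * (h * m)"
    by (simp add: power2_sum power_mult_distrib algebra_simps)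
  also have "\<dots> = 8 * A + 16 * (sqrt 2 - 1) * (h * m)"
    by (simp add: A_def power2_eq_square algebra_simps)
  also have "\<dots> \<le> 8 * A + c^2 * (h * m)"
    using mult_right_mono_neg[OF c hm] by simp
  finally have "(8 * A + c^2 * (h * m)) * (h * m) \<le> 0"
    using hm by (simp add: mult_le_0_iff)
  then have "(c * h * m)^2 \<le> 4 * A * (- 2 * h * m)"
    by (simp add: power2_eq_square algebra_simps)
  then have "A * (x - z)^2 - (c * h * m) * (x - z) * y + (- 2 * h * m) * y^2 \<ge> 0"
    using hm by (intro quadratic_form_nonneg) (auto simp: A_def)
  also have "A * (x - z)^2 - (c * h * m) * (x - z) * y + (- 2 * h * m) * y^2 =
     x^2 * y^2 * (x - y)^2 + y^2 * z^2 * (y - z)^2 + z^2 * x^2 * (z - x)^2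
     + c * x * y * z * (x - y) * (y - z) * (z - x)"
    unfolding A_def h_def m_def by algebra
  finally show ?thesis .
qed

text \<open>When no coordinate vanishes, \<open>A\<close>, \<open>B\<close> and \<open>C\<close>
  have the signs of r s, s t and t r. They cannot all be positive: r, s, t would share a strict
  sign, while r + s + t = - r s t.\<close>

lemma U_nonneg:
  fixes c x y z :: real
  assumes c: "c^2 \<le> 16 * (sqrt 2 - 1)"
  shows "ev (U c) x y z \<ge> 0"
proof -
  define A where "A = z * x * (x - y) * (y - z)"
  define B where "B = x * y * (y - z) * (z - x)"
  define C where "C = y * z * (z - x) * (x - y)"
  have "A \<le> 0 \<or> B \<le> 0 \<or> C \<le> 0"
  proof (rule ccontr)
    assume "\<not> ?thesis"
    then have pos: "A > 0" "B > 0" "C > 0" by auto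
    \<comment> \<open>\<open>r (r + s + t) = - r\<^sup>2 s t\<close> after clearing denominators\<close>
    have "x^2 * y^2 * (x - y)^2 + y^2 * A + x^2 * C + (x - y)^2 * B = 0"
      unfolding A_def B_def C_def by algebra
    moreover have "y \<noteq> 0" using pos(2) by (auto simp: B_def)
    then have "y^2 * A > 0" using pos(1) by simp
    moreover have "x^2 * C \<ge> 0" "(x - y)^2 * B \<ge> 0" "x^2 * y^2 * (x - y)^2 \<ge> 0" using pos by auto
    ultimately show False by linarith
  qed
  \<comment> \<open>U_c is invariant under cyclic shifts of the variables, so each of the three
    cases is an instance of the previous lemma.\<close>
  then show ?thesis
    unfolding eval_at_U A_def B_def C_def
    using U_nonneg_of_opposite_signs[OF c, of z x y] U_nonneg_of_opposite_signs[OF c, of x y z]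
      U_nonneg_of_opposite_signs[OF c, of y z x]
    by (auto simp: algebra_simps)
qed

text \<open>At this point (x - y)/z = (y - z)/x = r and (z - x)/y = - 2 r / (1 + r^2). The choice of
  r^2 makes the product of r and the third ratio - sqrt 2, the equality case of the square used for
  nonnegativity.\<close>

lemma U_at_equal_ratios:
  fixes c r :: real
  assumes "r^2 = 1 + sqrt 2"
  shows "ev (U c) (1 + r) (1 + r^2) (1 - r) = 4 * (1 + sqrt 2) * (2 + sqrt 2) * (4 - c * r)"
proof -
  have "ev (U c) (1 + r) (1 + r^2) (1 - r) =
      2 * r^2 * (1 - r^2)^2 * ((1 + r^2)^2 + 2 - (1 + r^2) * (c * r))"
    unfolding eval_at_U by algebra
  also have "\<dots> = 4 * (1 + sqrt 2) * ((2 + sqrt 2)^2 + 2 - (2 + sqrt 2) * (c * r))"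
    unfolding assms by simp
  also have "(2 + sqrt 2)^2 + 2 = 4 * (2 + sqrt 2)"
    by (simp add: power2_sum)
  finally show ?thesis by (simp add: algebra_simps)
qed

lemma psd_U_iff: "psd (U c) \<longleftrightarrow> c^2 \<le> 16 * (sqrt 2 - 1)"
proof
  assume "c^2 \<le> 16 * (sqrt 2 - 1)"
  moreover have "v = vector [v $ 1, v $ 2, v $ 3]" for v :: "real^3"
    by (simp add: vec_eq_iff forall_3)
  ultimately show "psd (U c)"
    unfolding psd_def by (metis U_nonneg)
next
  assume psd: "psd (U c)"
  have le: "c * r \<le> 4" if "r^2 = 1 + sqrt 2" for r
  proof -
    have "0 \<le> 4 * (1 + sqrt 2) * (2 + sqrt 2) * (4 - c * r)"
      using psd U_at_equal_ratios[OF that, of c] unfolding psd_def by metis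
    moreover have "0 < 4 * (1 + sqrt 2) * (2 + sqrt 2)"
      by (intro mult_pos_pos add_pos_pos) auto
    ultimately show ?thesis by (simp add: zero_le_mult_iff)
  qed
  define r where "r = sqrt (1 + sqrt 2)"
  have r2: "r^2 = 1 + sqrt 2" by (simp add: r_def)
  \<comment> \<open>Both square roots of 1 + sqrt 2 are admissible, which bounds c r from both
    sides.\<close>
  have "\<bar>c * r\<bar> \<le> 4" using le[of r] le[of "- r"] r2 by auto
  then have "(c * r)^2 \<le> 4^2" using abs_le_square_iff[of "c * r" 4] by simp
  then have "c^2 * (1 + sqrt 2) \<le> 16" by (simp add: power_mult_distrib r2)
  \<comment> \<open>The factors 1 + sqrt 2 and sqrt 2 - 1 are reciprocal.\<close>
  then have "c^2 * (1 + sqrt 2) * (sqrt 2 - 1) \<le> 16 * (sqrt 2 - 1)"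
    by (rule mult_right_mono) simp
  moreover have "c^2 * (1 + sqrt 2) * (sqrt 2 - 1) = c^2" by (simp add: algebra_simps)
  ultimately show "c^2 \<le> 16 * (sqrt 2 - 1)" by simp
qed

section \<open>Sums of squares\<close>

lemma eval_at_scale:
  assumes "is_form d f"
  shows "eval_at (t *\<^sub>R v) f = t ^ d * eval_at v f"
proof -
  have "(\<Prod>i\<in>UNIV. (t * v $ i) ^ Poly_Mapping.lookup m i) = t ^ d * (\<Prod>i\<in>UNIV. (v $ i) ^ Poly_Mapping.lookup m i)"
    if "m \<in> Poly_Mapping.keys f" for m
    using assms that
    by (simp add: is_form_def mdeg_def power_mult_distrib prod.distrib flip: power_sum)
  then show ?thesis
    by (simp add: eval_at_def sum_distrib_left algebra_simps)
qed

lemma eval_at_sum_list_squares: "eval_at v (\<Sum>f\<leftarrow>fs. f\<^sup>2) = (\<Sum>f\<leftarrow>fs. (eval_at v f)\<^sup>2)"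
  by (induction fs) (simp_all add: eval_at_add eval_at_mult power2_eq_square)

lemma member_le_sum_list_squares:
  fixes g :: "'a \<Rightarrow> real"
  shows "f \<in> set fs \<Longrightarrow> (g f)\<^sup>2 \<le> (\<Sum>f\<leftarrow>fs. (g f)\<^sup>2)"
proof (induction fs)
  case (Cons a fs)
  have "(\<Sum>f\<leftarrow>fs. (g f)\<^sup>2) \<ge> 0" by (induction fs) auto
  then show ?case using Cons by (auto simp: add_increasing)
qed simp

text \<open>\<open>sos\<close> leaves the degrees of the summands open; growth along a ray fixes
  them. Large t excludes d > n and small t excludes d < n.\<close>

lemma degree_of_square_summand:
  fixes e K :: real
  assumes bd: "\<And>t. t > 0 \<Longrightarrow> (t ^ d * e)\<^sup>2 \<le> (t ^ n)\<^sup>2 * K"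
  shows "e = 0 \<or> d = n"
proof (rule ccontr)
  assume "\<not> ?thesis"
  then have e: "e\<^sup>2 > 0" and dn: "d \<noteq> n" by auto
  \<comment> \<open>Chosen so that s >= 1 and s e^2 = e^2 + K > K; then t = s refutes d > n, and t =
    1/s refutes d < n.\<close>
  define s where "s = 1 + K / e\<^sup>2"
  have "e\<^sup>2 \<le> K" using bd[of 1] by simp
  then have "K \<ge> 0" using zero_le_power2 order_trans by blast
  then have s: "s \<ge> 1" by (simp add: s_def)
  have se: "s * e\<^sup>2 > K" using e by (simp add: s_def algebra_simps)
  have *: "(s ^ (Suc k))\<^sup>2 * e\<^sup>2 > K" for k
  proof -
    have "s ^ 1 \<le> s ^ (Suc k * 2)" using s by (intro power_increasing) auto
    then have "s * e\<^sup>2 \<le> (s ^ (Suc k))\<^sup>2 * e\<^sup>2"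
      by (intro mult_right_mono) (simp_all only: power_mult power_one_right zero_le_power2)
    then show ?thesis using se by linarith
  qed
  consider k where "d = n + Suc k" | k where "n = d + Suc k"
    using dn by (metis less_imp_Suc_add add_Suc_right linorder_neqE_nat)
  then show False
  proof cases
    case 1
    have "(s ^ n)\<^sup>2 * ((s ^ Suc k)\<^sup>2 * e\<^sup>2) \<le> (s ^ n)\<^sup>2 * K"
      using bd[of s] s unfolding 1 power_add power_mult_distrib by (simp only: mult.assoc)
    then show False using *[of k] s by (simp add: mult_le_cancel_left_pos)
  next
    case 2
    define t where "t = inverse s"
    have t: "t > 0" "t * s = 1" using s by (auto simp: t_def)
    have "(t ^ d)\<^sup>2 * e\<^sup>2 \<le> (t ^ d)\<^sup>2 * ((t ^ Suc k)\<^sup>2 * K)"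
      using bd[of t] t unfolding 2 power_add power_mult_distrib by (simp only: mult.assoc)
    then have "e\<^sup>2 \<le> (t ^ Suc k)\<^sup>2 * K"
      using t by (simp add: mult_le_cancel_left_pos)
    then have "(s ^ Suc k)\<^sup>2 * e\<^sup>2 \<le> (s ^ Suc k)\<^sup>2 * ((t ^ Suc k)\<^sup>2 * K)"
      by (intro mult_left_mono) auto
    also have "\<dots> = ((t * s) ^ Suc k)\<^sup>2 * K"
      by (simp only: power_mult_distrib mult_ac)
    finally show False using *[of k] t by simp
  qed
qed

text \<open>Stated for functions with explicit coefficients, so that vanishing at a point becomes a
  linear equation in the ten coefficients.\<close>

definition ternary_cubic :: "(real \<Rightarrow> real \<Rightarrow> real \<Rightarrow> real) \<Rightarrow> bool" where
  "ternary_cubic g \<longleftrightarrow> (\<exists>a1 a2 a3 a4 a5 a6 a7 a8 a9 a10. \<forall>x y z. g x y z =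
     a1 * x^3 + a2 * y^3 + a3 * z^3 + a4 * (x^2 * y) + a5 * (x * y^2) + a6 * (y^2 * z)
     + a7 * (y * z^2) + a8 * (z^2 * x) + a9 * (z * x^2) + a10 * (x * y * z))"

lemma ternary_cubicI:
  "(\<And>x y z. g x y z =
     a1 * x^3 + a2 * y^3 + a3 * z^3 + a4 * (x^2 * y) + a5 * (x * y^2) + a6 * (y^2 * z)
     + a7 * (y * z^2) + a8 * (z^2 * x) + a9 * (z * x^2) + a10 * (x * y * z)) \<Longrightarrow> ternary_cubic g"
  unfolding ternary_cubic_def by blast

lemma ternary_cubic_add:
  assumes "ternary_cubic g" "ternary_cubic h"
  shows "ternary_cubic (\<lambda>x y z. g x y z + h x y z)"
proof -
  from assms(1) obtain a1 a2 a3 a4 a5 a6 a7 a8 a9 a10 where g: "\<And>x y z. g x y z =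
     a1 * x^3 + a2 * y^3 + a3 * z^3 + a4 * (x^2 * y) + a5 * (x * y^2) + a6 * (y^2 * z)
     + a7 * (y * z^2) + a8 * (z^2 * x) + a9 * (z * x^2) + a10 * (x * y * z)"
    unfolding ternary_cubic_def by blast
  from assms(2) obtain b1 b2 b3 b4 b5 b6 b7 b8 b9 b10 where h: "\<And>x y z. h x y z =
     b1 * x^3 + b2 * y^3 + b3 * z^3 + b4 * (x^2 * y) + b5 * (x * y^2) + b6 * (y^2 * z)
     + b7 * (y * z^2) + b8 * (z^2 * x) + b9 * (z * x^2) + b10 * (x * y * z)"
    unfolding ternary_cubic_def by blast
  show ?thesis
    by (rule ternary_cubicI[of _ "a1 + b1" "a2 + b2" "a3 + b3" "a4 + b4" "a5 + b5" "a6 + b6"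
          "a7 + b7" "a8 + b8" "a9 + b9" "a10 + b10"])
      (simp add: g h algebra_simps)
qed

lemma ternary_cubic_monomial:
  assumes "i + j + k = 3"
  shows "ternary_cubic (\<lambda>x y z. a * (x ^ i * y ^ j * z ^ k))"
proof -
  \<comment> \<open>Two exponents determine the third, so \<delta> is indexed by those of x and y;
    only the coefficient of the given monomial is \<open>a\<close>.\<close>
  define \<delta> where "\<delta> p q = (if i = p \<and> j = q then a else 0)" for p q
  have "(i, j, k) \<in> {(3, 0, 0), (0, 3, 0), (0, 0, 3), (2, 1, 0), (1, 2, 0), (0, 2, 1), (0, 1, 2),
      (1, 0, 2), (2, 0, 1), (1, 1, 1)}"
  proof -
    have "i = 0 \<or> i = 1 \<or> i = 2 \<or> i = 3" "j = 0 \<or> j = 1 \<or> j = 2 \<or> j = 3" using assms by linarith+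
    then show ?thesis using assms by (elim disjE) simp_all
  qed
  then show ?thesis
    by (elim insertE emptyE;
        intro ternary_cubicI[of _ "\<delta> 3 0" "\<delta> 0 3" "\<delta> 0 0" "\<delta> 2 1" "\<delta> 1 2" "\<delta> 0 2" "\<delta> 0 1"
          "\<delta> 1 0" "\<delta> 2 0" "\<delta> 1 1"];
        simp add: \<delta>_def)
qed

lemma ternary_cubic_ev:
  assumes "is_form 3 f"
  shows "ternary_cubic (ev f)"
proof -
  \<comment> \<open>The index set is generalized from \<open>keys f\<close> to any finite
    \<open>K\<close>, so that the induction keeps the coefficients of the fixed
    \<open>f\<close>.\<close>
  have "ternary_cubic (\<lambda>x y z. \<Sum>m\<in>K. Poly_Mapping.lookup f m * (\<Prod>i\<in>UNIV. (vector [x, y, z] $ i) ^ Poly_Mapping.lookup m i))"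
    if "finite K" "\<forall>m\<in>K. mdeg m = 3" for K :: "(3 \<Rightarrow>\<^sub>0 nat) set"
    using that
  proof (induction K rule: finite_induct)
    case empty
    show ?case by (rule ternary_cubicI[of _ 0 0 0 0 0 0 0 0 0 0]) simp
  next
    case (insert m K)
    have prod3: "(\<Prod>i\<in>UNIV. (vector [x, y, z] $ i) ^ Poly_Mapping.lookup m i) =
        x ^ Poly_Mapping.lookup m 1 * y ^ Poly_Mapping.lookup m 2 * z ^ Poly_Mapping.lookup m 3" for x y z :: real
      unfolding UNIV_3 by (simp add: mult.assoc)
    have "mdeg m = 3" using insert.prems by blast
    then have "Poly_Mapping.lookup m 1 + Poly_Mapping.lookup m 2 + Poly_Mapping.lookup m 3 = 3"
      by (simp only: mdeg_def sum_3)
    from ternary_cubic_monomial[OF this, of "Poly_Mapping.lookup f m"]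
    have "ternary_cubic (\<lambda>x y z. Poly_Mapping.lookup f m * (\<Prod>i\<in>UNIV. (vector [x, y, z] $ i) ^ Poly_Mapping.lookup m i))"
      unfolding prod3 .
    from ternary_cubic_add[OF this insert.IH] show ?case
      using insert by simp
  qed
  from this[of "Poly_Mapping.keys f"] assms show ?thesis
    by (simp add: is_form_def eval_at_def)
qed

text \<open>The unit vectors kill the cubes, each point with two ones makes a pair such as x^2 y, x
  y^2 have opposite coefficients, and (1,1,1) then kills x y z.\<close>

lemma ternary_cubic_through_seven_points:
  assumes "ternary_cubic g"
    and "g 1 0 0 = 0" "g 0 1 0 = 0" "g 0 0 1 = 0" "g 1 1 0 = 0" "g 1 0 1 = 0" "g 0 1 1 = 0"
      "g 1 1 1 = 0"
  shows "\<exists>p q s. \<forall>x y z. g x y z = p * (x * y * (x - y)) + q * (y * z * (y - z)) + s * (z * x * (z - x))"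
proof -
  from assms(1) obtain a1 a2 a3 a4 a5 a6 a7 a8 a9 a10 where g: "\<And>x y z. g x y z =
     a1 * x^3 + a2 * y^3 + a3 * z^3 + a4 * (x^2 * y) + a5 * (x * y^2) + a6 * (y^2 * z)
     + a7 * (y * z^2) + a8 * (z^2 * x) + a9 * (z * x^2) + a10 * (x * y * z)"
    unfolding ternary_cubic_def by blast
  have "a1 = 0" "a2 = 0" "a3 = 0" "a5 = - a4" "a7 = - a6" "a9 = - a8" "a10 = 0"
    using assms(2-) by (simp_all add: g)
  then have "g x y z = a4 * (x * y * (x - y)) + a6 * (y * z * (y - z)) + a8 * (z * x * (z - x))"
    for x y z
    by (simp add: g power2_eq_square algebra_simps)
  then show ?thesis by blast
qed

text \<open>Collapses a list of unknown length to six unknown numbers, which can then be found by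
  evaluation.\<close>

lemma sum_list_squares_quadratic_form:
  fixes g :: "'f \<Rightarrow> 'p \<Rightarrow> real"
  assumes "\<forall>f\<in>set fs. \<exists>p q s. \<forall>v. g f v = p * a v + q * b v + s * d v"
  shows "\<exists>A B D E F G. \<forall>v. (\<Sum>f\<leftarrow>fs. (g f v)\<^sup>2) =
    A * (a v)\<^sup>2 + B * (b v)\<^sup>2 + D * (d v)\<^sup>2 + E * (a v * b v) + F * (b v * d v) + G * (d v * a v)"
  using assms
proof (induction fs)
  case Nil
  show ?case by (rule exI[of _ 0])+ simp
next
  case (Cons f fs)
  then obtain A B D E F G where IH: "\<And>v. (\<Sum>f\<leftarrow>fs. (g f v)\<^sup>2) =
    A * (a v)\<^sup>2 + B * (b v)\<^sup>2 + D * (d v)\<^sup>2 + E * (a v * b v) + F * (b v * d v) + G * (d v * a v)"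
    by auto
  from Cons.prems obtain p q s where f: "\<And>v. g f v = p * a v + q * b v + s * d v"
    by auto
  have "(\<Sum>f\<leftarrow>f # fs. (g f v)\<^sup>2) = (A + p\<^sup>2) * (a v)\<^sup>2 + (B + q\<^sup>2) * (b v)\<^sup>2 + (D + s\<^sup>2) * (d v)\<^sup>2
      + (E + 2 * p * q) * (a v * b v) + (F + 2 * q * s) * (b v * d v) + (G + 2 * s * p) * (d v * a v)"
    for v
    by (simp only: list.map sum_list.Cons IH f) (simp add: power2_eq_square algebra_simps)
  then show ?case by blast
qed

lemma sos_U_imp:
  assumes "sos (U c)"
  shows "c = 0"
proof -
  from assms obtain fs where forms: "\<forall>f\<in>set fs. \<exists>d. is_form d f" and U: "U c = (\<Sum>f\<leftarrow>fs. f\<^sup>2)"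
    unfolding sos_def by blast
  have ev_U: "eval_at v (U c) = (\<Sum>f\<leftarrow>fs. (eval_at v f)\<^sup>2)" for v
    by (simp add: U eval_at_sum_list_squares)
  have bound: "(eval_at v f)\<^sup>2 \<le> eval_at v (U c)" if "f \<in> set fs" for f v
    using member_le_sum_list_squares[OF that, of "eval_at v"] ev_U by simp
  have cubic: "ternary_cubic (ev f)" if f: "f \<in> set fs" for f
  proof -
    from forms f obtain d where d: "is_form d f" by blast
    have "eval_at v f = 0 \<or> d = 3" for v
    proof (rule degree_of_square_summand)
      fix t :: real
      show "(t ^ d * eval_at v f)\<^sup>2 \<le> (t ^ 3)\<^sup>2 * eval_at v (U c)"
        using bound[OF f, of "t *\<^sub>R v"]
        by (simp add: eval_at_scale[OF d] eval_at_scale[OF is_form_U])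
    qed
    \<comment> \<open>The degree \<open>d\<close> is the same at all points, so if it is not 3, then
      \<open>f\<close> vanishes everywhere.\<close>
    then consider "d = 3" | "\<And>v. eval_at v f = 0" by blast
    then show ?thesis
    proof cases
      case 1
      then show ?thesis using d ternary_cubic_ev by simp
    next
      case 2
      then show ?thesis by (intro ternary_cubicI[of _ 0 0 0 0 0 0 0 0 0 0]) simp
    qed
  qed
  have "\<exists>p q s. \<forall>x y z. ev f x y z = p * (x * y * (x - y)) + q * (y * z * (y - z)) + s * (z * x * (z - x))"
    if f: "f \<in> set fs" for f
  proof -
    have "ev f x y z = 0" if "ev (U c) x y z = 0" for x y z
      using bound[OF f, of "vector [x, y, z]"] that by simp
    then show ?thesis
      by (intro ternary_cubic_through_seven_points cubic f) (simp_all add: eval_at_U)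
  qed
  then have "\<forall>f\<in>set fs. \<exists>p q s. \<forall>v. (\<lambda>(x, y, z). ev f x y z) v =
      p * (\<lambda>(x, y, z). x * y * (x - y)) v + q * (\<lambda>(x, y, z). y * z * (y - z)) v
      + s * (\<lambda>(x, y, z). z * x * (z - x)) v"
    by simp
  from sum_list_squares_quadratic_form[OF this] obtain A B D E F G where
    "\<And>x y z. (\<Sum>f\<leftarrow>fs. (ev f x y z)\<^sup>2) =
      A * (x * y * (x - y))\<^sup>2 + B * (y * z * (y - z))\<^sup>2 + D * (z * x * (z - x))\<^sup>2
      + E * ((x * y * (x - y)) * (y * z * (y - z))) + F * ((y * z * (y - z)) * (z * x * (z - x)))
      + G * ((z * x * (z - x)) * (x * y * (x - y)))"
    by auto
  then have eq: "x^2 * y^2 * (x - y)^2 + y^2 * z^2 * (y - z)^2 + z^2 * x^2 * (z - x)^2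
     + c * x * y * z * (x - y) * (y - z) * (z - x) =
      A * (x * y * (x - y))\<^sup>2 + B * (y * z * (y - z))\<^sup>2 + D * (z * x * (z - x))\<^sup>2
      + E * ((x * y * (x - y)) * (y * z * (y - z))) + F * ((y * z * (y - z)) * (z * x * (z - x)))
      + G * ((z * x * (z - x)) * (x * y * (x - y)))" for x y z
    by (simp flip: eval_at_U add: ev_U)
  \<comment> \<open>At each of these points one coordinate is 0, so two of the three cubics vanish
    and a single square remains.\<close>
  have ABD: "A = 1" "B = 1" "D = 1"
    using eq[of 1 "-1" 0] eq[of 0 1 "-1"] eq[of "-1" 0 1] by simp_all
  \<comment> \<open>Two equal coordinates kill the term with c and one of the cubics, leaving one
    mixed product with a nonzero value.\<close>
  have "E = 0" "F = 0" "G = 0"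
    using eq[of 1 2 1] eq[of 1 1 2] eq[of 2 1 1] by (simp_all add: ABD)
  \<comment> \<open>With all six coefficients known, only the term with c is left; at (1,2,3) it
    equals 12 c.\<close>
  then show "c = 0"
    using eq[of 1 2 3] by (simp add: ABD)
qed

theorem mainTheorem9:
  fixes c :: real
  shows "(psd (U c) \<longleftrightarrow> \<bar>c\<bar> \<le> 4 * sqrt (sqrt 2 - 1)) \<and> (sos (U c) \<longrightarrow> c = 0)"
proof -
  have "\<bar>c\<bar> \<le> 4 * sqrt (sqrt 2 - 1) \<longleftrightarrow> c^2 \<le> (4 * sqrt (sqrt 2 - 1))^2"
    using abs_le_square_iff[of c "4 * sqrt (sqrt 2 - 1)"] by simp
  also have "(4 * sqrt (sqrt 2 - 1))^2 = 16 * (sqrt 2 - 1)"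
    by (simp add: power_mult_distrib)
  finally show ?thesis
    using psd_U_iff sos_U_imp by simp
qed

end
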